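(* Let $p$ be a prime and let $G$ be a finite abelian $p$-group with $\exp(G)=q$ and $\left\lceil \frac{D(G)}{q}\right\rceil = d$. If $K\subseteq [1,p]$ is a set of positive integers satisfying $|K|\ge d$, then $$s_{Kq}(G)\le (\max K+1-|K|)\,q+D(G)-1,$$ where $Kq=\{kq : k\in K\}$.
   Context: $[a,b]$ denotes the set of integers $\{a,a+1,\ldots,b\}$. $\exp(G)$ is the exponent of the finite abelian group $G$ (written additively), i.e. the largest order of an element of $G$. A sequence over $G$ is a finite sequence of elements of $G$, repetitions allowed, order irrelevant (a finite multiset); its length is the number of terms counted with multiplicity; a subsequence is a sub-multiset; a sequence is zero-sum if the sum of its terms is $0$. $D(G)$ is the Davenport constant of $G$: the smallest positive integer $\ell$ such that every sequence over $G$ of length $\ell$ has a nonempty zero-sum subsequence. For a set $K$ of positive integers, $s_K(G)$ is the smallest positive integer $\ell$ such that every sequence over $G$ of length at least $\ell$ has a zero-sum subsequence whose length lies in $K$ ($s_K(G)=\infty$ if no such $\ell$ exists). *)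

theory Defs
  imports
    "HOL-Algebra.Multiplicative_Group"
    "HOL-Computational_Algebra.Primes"
    "HOL-Library.Multiset"
    "HOL-Library.Extended_Nat"
begin

text \<open>
  Groups are written multiplicatively, as everywhere in HOL-Algebra, so
  zero-sum reads ``product equal to \<open>\<one>\<close>''.
  Sequences are multisets, subsequences are sub-multisets.
\<close>

definition seq_over :: "('a, 'b) monoid_scheme \<Rightarrow> 'a multiset \<Rightarrow> bool" where
  "seq_over G S \<longleftrightarrow> set_mset S \<subseteq> carrier G"

text \<open>The sum of a sequence, in additive notation $\sum_{g} v_g(S)\, g$
  with $v_g(S)$ the multiplicity of $g$ in $S$.\<close>

definition seq_sum :: "('a, 'b) monoid_scheme \<Rightarrow> 'a multiset \<Rightarrow> 'a" where
  "seq_sum G S = finprod G (\<lambda>g. g [^]\<^bsub>G\<^esub> count S g) (set_mset S)"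

definition zero_sum :: "('a, 'b) monoid_scheme \<Rightarrow> 'a multiset \<Rightarrow> bool" where
  "zero_sum G S \<longleftrightarrow> seq_sum G S = \<one>\<^bsub>G\<^esub>"

definition group_exp :: "('a, 'b) monoid_scheme \<Rightarrow> nat" where
  "group_exp G = Max (group.ord G ` carrier G)"

definition davenport :: "('a, 'b) monoid_scheme \<Rightarrow> nat" where
  "davenport G = (LEAST l. 0 < l \<and>
     (\<forall>S. seq_over G S \<and> size S = l \<longrightarrow> (\<exists>T. T \<subseteq># S \<and> T \<noteq> {#} \<and> zero_sum G T)))"

text \<open>The infimum in \<^typ>\<open>enat\<close> is attained for a nonempty set, and it is
  \<open>\<infinity>\<close> if no admissible length exists.\<close>

definition s_const :: "nat set \<Rightarrow> ('a, 'b) monoid_scheme \<Rightarrow> enat" where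
  "s_const K G = Inf {enat l | l. 0 < l \<and>
     (\<forall>S. seq_over G S \<and> l \<le> size S \<longrightarrow> (\<exists>T. T \<subseteq># S \<and> size T \<in> K \<and> zero_sum G T))}"

lemma (in comm_group) seq_sum_empty: "seq_sum G {#} = \<one>"
  by (simp add: seq_sum_def)

lemma (in comm_group) seq_sum_add_mset:
  assumes "g \<in> carrier G" "seq_over G S"
  shows "seq_sum G (add_mset g S) = g \<otimes> seq_sum G S"
proof -
  have S: "x \<in> carrier G" if "x \<in># S" for x
    using that assms(2) by (auto simp: seq_over_def)
  let ?A = "set_mset S - {g}"
  define F where "F = (\<lambda>x. x [^] count S x)"
  define F' where "F' = (\<lambda>x. x [^] count (add_mset g S) x)"
  have F: "F \<in> ?A \<rightarrow> carrier G" and Fg: "F g \<in> carrier G"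
    using S assms(1) unfolding F_def by (blast intro: nat_pow_closed)+
  have c: "finprod G F ?A \<in> carrier G"
    by (rule finprod_closed[OF F])
  have eq: "F' x = F x" if "x \<in> ?A" for x
    using that unfolding F_def F'_def by auto
  have F': "F' \<in> ?A \<rightarrow> carrier G"
    using F eq by (simp add: Pi_iff)
  have F'g: "F' g = g \<otimes> F g"
    unfolding F_def F'_def using nat_pow_Suc2[OF assms(1)] by simp
  have A: "finprod G F' ?A = finprod G F ?A"
    by (rule finprod_cong'[OF refl F eq])
  have "seq_sum G (add_mset g S) = finprod G F' (insert g ?A)"
    unfolding seq_sum_def F'_def by simp
  also have "\<dots> = F' g \<otimes> finprod G F' ?A"
    by (rule finprod_insert) (use F' F'g Fg assms(1) m_closed in \<open>simp_all del: Pi_iff\<close>)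
  also have "\<dots> = g \<otimes> (F g \<otimes> finprod G F ?A)"
    unfolding A F'g by (rule m_assoc[OF assms(1) Fg c])
  also have "F g \<otimes> finprod G F ?A = seq_sum G S"
  proof (cases "g \<in># S")
    case True
    then have "seq_sum G S = finprod G F (insert g ?A)"
      unfolding seq_sum_def F_def by (simp only: insert_Diff)
    also have "\<dots> = F g \<otimes> finprod G F ?A"
      by (rule finprod_insert[OF _ _ F Fg]) simp_all
    finally show ?thesis by (rule sym)
  next
    case False
    then have "F g = \<one>" and "?A = set_mset S"
      unfolding F_def by (auto simp: not_in_iff)
    then show ?thesis using l_one[OF c] by (simp only: seq_sum_def F_def)
  qed
  finally show ?thesis .
qed

end

theory Submission
  imports Defs "HOL-Library.Poly_Mapping"
begin

text \<open>
  In the group algebra of \<open>G\<close> over the field with \<open>p\<close> elements, any product of \<open>D(G)\<close> factors \<open>1 - g\<close>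
  vanishes. For this, take a nonzero product of maximal length, and among these one whose sum of
  squared multiplicities is maximal; an exchange argument shows that its sequence has no zero-sum
  subsequence, so its length is less than \<open>D(G)\<close>. This needs no decomposition of \<open>G\<close> into cyclic groups.

  Reading off the coefficient at the identity, the sum of \<open>(-1)\<^bsup>|T|\<^esup> f(|T|)\<close> over the zero-sum
  subsequences \<open>T\<close> of a sequence of length \<open>l\<close> is divisible by \<open>p\<close> for every integer-valued polynomial
  \<open>f\<close> of degree at most \<open>l - D(G)\<close>. For \<open>l = (max K + 1 - |K|) q + D(G) - 1\<close> choose \<open>f\<close> such that,
  modulo \<open>p\<close>, \<open>f(t)\<close> vanishes unless \<open>q\<close> divides \<open>t\<close>, \<open>f(jq)\<close> vanishes for \<open>j\<close> in \<open>[1, max K] - K\<close>, and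
  \<open>f(0)\<close> does not vanish. As \<open>l < (max K + 1) q\<close>, a sequence without zero-sum subsequences of length in \<open>Kq\<close>
  would leave only the empty subsequence, with a contribution prime to \<open>p\<close>.
\<close>

subsection \<open>Functions of bounded degree\<close>

text \<open>Polynomials are captured by the vanishing of the difference of order
  \<open>e + 1\<close>, so that integer-valued ones such as binomial coefficients need no rational
  coefficients.\<close>

primrec fdeg_le :: "nat \<Rightarrow> (nat \<Rightarrow> int) \<Rightarrow> bool" where
  "fdeg_le 0 f \<longleftrightarrow> (\<forall>t. f (Suc t) - f t = 0)"
| "fdeg_le (Suc e) f \<longleftrightarrow> fdeg_le e (\<lambda>t. f (Suc t) - f t)"

lemma fdeg_le_add: "fdeg_le e f \<Longrightarrow> fdeg_le e g \<Longrightarrow> fdeg_le e (\<lambda>t. f t + g t)"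
proof (induction e arbitrary: f g)
  case (Suc e)
  then have "fdeg_le e (\<lambda>t. (f (Suc t) - f t) + (g (Suc t) - g t))" by simp
  then show ?case by (simp add: algebra_simps)
qed auto

lemma fdeg_le_0: "fdeg_le e (\<lambda>t. 0)"
  by (induction e) auto

lemma fdeg_le_const: "fdeg_le e (\<lambda>t. c)"
  by (cases e) (auto simp: fdeg_le_0)

lemma fdeg_le_shift: "fdeg_le e f \<Longrightarrow> fdeg_le e (\<lambda>t. f (Suc t))"
proof (induction e arbitrary: f)
  case (Suc e)
  from Suc.IH[of "\<lambda>t. f (Suc t) - f t"] Suc.prems show ?case by simp
qed auto

text \<open>Discrete Leibniz rule: the difference of the product is
  \<open>F t * g (Suc t) + f t * G t\<close>. Each summand has smaller total degree, or is zero when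
  the differenced factor is constant.\<close>

lemma fdeg_le_mult: "fdeg_le a f \<Longrightarrow> fdeg_le b g \<Longrightarrow> fdeg_le (a + b) (\<lambda>t. f t * g t)"
proof (induction "a + b" arbitrary: a b f g)
  case 0
  then show ?case by simp
next
  case (Suc m)
  define F where "F = (\<lambda>t. f (Suc t) - f t)"
  define G where "G = (\<lambda>t. g (Suc t) - g t)"
  have 1: "fdeg_le m (\<lambda>t. F t * g (Suc t))"
  proof (cases a)
    case 0
    with Suc.prems have "F = (\<lambda>t. 0)" by (auto simp: F_def)
    then show ?thesis by (simp add: fdeg_le_0)
  next
    case (Suc a')
    then have "fdeg_le a' F" using Suc.prems by (simp add: F_def)
    moreover have "m = a' + b" using Suc.hyps(2) Suc by simp
    ultimately show ?thesis
      using Suc.hyps(1)[of a' b F "\<lambda>t. g (Suc t)"] fdeg_le_shift[OF Suc.prems(2)] by blast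
  qed
  have 2: "fdeg_le m (\<lambda>t. f t * G t)"
  proof (cases b)
    case 0
    with Suc.prems have "G = (\<lambda>t. 0)" by (auto simp: G_def)
    then show ?thesis by (simp add: fdeg_le_0)
  next
    case (Suc b')
    then have "fdeg_le b' G" using Suc.prems by (simp add: G_def)
    moreover have "m = a + b'" using Suc.hyps(2) Suc by simp
    ultimately show ?thesis using Suc.hyps(1)[of a b' f G] Suc.prems(1) by blast
  qed
  have "fdeg_le m (\<lambda>t. f (Suc t) * g (Suc t) - f t * g t)"
    using fdeg_le_add[OF 1 2] by (simp add: F_def G_def algebra_simps)
  then show ?case by (simp flip: Suc.hyps(2))
qed

lemma fdeg_le_prod:
  assumes "finite A" "\<And>j. j \<in> A \<Longrightarrow> fdeg_le e (f j)"
  shows "fdeg_le (card A * e) (\<lambda>t. \<Prod>j\<in>A. f j t)"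
  using assms by (induction rule: finite_induct) (simp_all add: fdeg_le_mult fdeg_le_const del: fdeg_le.simps)

lemma fdeg_le_choose: "fdeg_le e (\<lambda>t. int ((t + c) choose e))"
proof (induction e)
  case (Suc e)
  then show ?case by simp
qed auto

text \<open>Newton's forward difference formula, by summing the expansion of the difference. It is
  useful because \<open>t choose j\<close> counts the \<open>j\<close>-subsets of a
  \<open>t\<close>-set.\<close>

lemma newton_expansion:
  assumes "fdeg_le e f"
  shows "\<exists>c. \<forall>t. f t = (\<Sum>j\<le>e. c j * int (t choose j))"
  using assms
proof (induction e arbitrary: f)
  case 0
  then have "f t = f 0" for t by (induction t) auto
  then obtain k where "\<And>t. f t = k" by blast
  then show ?case by (intro exI[of _ "\<lambda>_. k"]) simp
next
  case (Suc e)
  then obtain c where c: "\<And>t. f (Suc t) - f t = (\<Sum>j\<le>e. c j * int (t choose j))"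
    using Suc.IH[of "\<lambda>t. f (Suc t) - f t"] by auto
  have "f t = f 0 + (\<Sum>j\<le>e. c j * int (t choose Suc j))" for t
  proof (induction t)
    case (Suc t)
    have "f (Suc t) = f t + (\<Sum>j\<le>e. c j * int (t choose j))" using c[of t] by simp
    then show ?case by (simp add: Suc.IH sum.distrib algebra_simps)
  qed simp
  then obtain k where "\<And>t. f t = k + (\<Sum>j\<le>e. c j * int (t choose Suc j))" by blast
  then show ?case
    by (intro exI[of _ "case_nat k c"]) (simp add: sum.atMost_Suc_shift del: sum.atMost_Suc)
qed

subsection \<open>Congruences for prime powers\<close>

lemma prime_dvd_if_primepow_dvd_mult:
  fixes a b :: nat
  assumes "prime p" "p ^ k dvd a * b" "\<not> p ^ k dvd a"
  shows "p dvd b"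
proof (rule ccontr)
  assume "\<not> p dvd b"
  then have "coprime (p ^ k) b" using assms(1) by (simp add: prime_imp_coprime)
  then show False using assms by (simp add: coprime_dvd_mult_left_iff)
qed

lemma prime_dvd_primepow_choose:
  assumes "prime (p::nat)" "0 < i" "i < p ^ k"
  shows "p dvd (p ^ k choose i)"
proof (rule prime_dvd_if_primepow_dvd_mult[OF assms(1)])
  obtain i' where i': "i = Suc i'" using assms(2) gr0_conv_Suc by auto
  obtain m where m: "p ^ k = Suc m" using assms(3) by (cases "p ^ k") auto
  show "p ^ k dvd i * (p ^ k choose i)"
    unfolding i' m by (metis Suc_times_binomial dvd_triv_left)
  show "\<not> p ^ k dvd i" using assms by (auto dest: dvd_imp_le)
qed

text \<open>By absorption, \<open>(t + q) * ((t + (q - 1)) choose (q - 1))\<close> equals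
  \<open>q * ((t + q) choose q)\<close>, while \<open>q\<close> does not divide
  \<open>t + q\<close>.\<close>

lemma prime_dvd_choose_shift:
  assumes p: "prime (p::nat)" and q: "q = p ^ k" and n: "\<not> q dvd t"
  shows "p dvd ((t + (q - 1)) choose (q - 1))"
proof (rule prime_dvd_if_primepow_dvd_mult[OF p])
  have "q > 0" using p q prime_gt_0_nat by simp
  then obtain m where m: "q = Suc m" by (cases q) auto
  show "p ^ k dvd (t + q) * ((t + (q - 1)) choose (q - 1))"
    using Suc_times_binomial[of m "t + m"] unfolding q[symmetric] m by (metis add_Suc_right diff_Suc_1 dvd_triv_left)
  show "\<not> p ^ k dvd t + q" using n q by simp
qed

text \<open>Vandermonde's identity for \<open>q + j * q\<close>: modulo \<open>p\<close> only the
  two extreme terms survive, namely the previous coefficient and 1.\<close>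

lemma primepow_mult_choose_cong:
  assumes p: "prime (p::nat)" and q: "q = p ^ k"
  shows "int p dvd int ((j * q) choose q) - int j"
proof (induction j)
  case 0
  have "q > 0" using p q prime_gt_0_nat by simp
  then show ?case by (simp add: binomial_eq_0)
next
  case (Suc j)
  have q0: "0 < q" using p q prime_gt_0_nat by simp
  have "(Suc j * q choose q) = (\<Sum>i\<le>q. (q choose i) * (j * q choose (q - i)))"
    using vandermonde[of q "j * q" q] by simp
  also have "{..q} = insert 0 (insert q {0<..<q})" using q0 by auto
  also have "(\<Sum>i\<in>\<dots>. (q choose i) * (j * q choose (q - i))) =
      (j * q choose q) + 1 + (\<Sum>i\<in>{0<..<q}. (q choose i) * (j * q choose (q - i)))"
    using q0 by simp
  finally have eq: "(Suc j * q choose q) =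
      (j * q choose q) + 1 + (\<Sum>i\<in>{0<..<q}. (q choose i) * (j * q choose (q - i)))" .
  have "p dvd (\<Sum>i\<in>{0<..<q}. (q choose i) * (j * q choose (q - i)))"
    by (intro dvd_sum dvd_mult2) (use prime_dvd_primepow_choose[OF p] q in auto)
  then obtain z where z: "(\<Sum>i\<in>{0<..<q}. (q choose i) * (j * q choose (q - i))) = p * z" ..
  have "int (Suc j * q choose q) - int (Suc j) = (int (j * q choose q) - int j) + int p * int z"
    unfolding eq z by simp
  then show ?case using Suc.IH by (metis dvd_add dvd_triv_left)
qed

lemma freshmans_dream_dvd:
  fixes x y :: "'r::comm_ring_1"
  assumes "prime p"
  shows "of_nat p dvd (x + y) ^ p - (x ^ p + y ^ p)"
proof -
  have p0: "0 < p" using assms prime_gt_0_nat by simp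
  have "(x + y) ^ p = (\<Sum>i\<le>p. of_nat (p choose i) * x ^ i * y ^ (p - i))"
    by (rule binomial_ring)
  also have "{..p} = insert 0 (insert p {0<..<p})" using p0 by auto
  also have "(\<Sum>i\<in>\<dots>. of_nat (p choose i) * x ^ i * y ^ (p - i)) =
     y ^ p + x ^ p + (\<Sum>i\<in>{0<..<p}. of_nat (p choose i) * x ^ i * y ^ (p - i))"
    using p0 by simp
  finally have "(x + y) ^ p - (x ^ p + y ^ p) =
     (\<Sum>i\<in>{0<..<p}. of_nat (p choose i) * x ^ i * y ^ (p - i))" by simp
  also have "of_nat p dvd \<dots>"
  proof (intro dvd_sum dvd_mult2)
    fix i assume "i \<in> {0<..<p}"
    then have "p dvd (p choose i)" using prime_dvd_primepow_choose[OF assms, of i 1] by simp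
    then show "(of_nat p :: 'r) dvd of_nat (p choose i)" by (auto simp: dvd_def)
  qed
  finally show ?thesis .
qed

lemma one_minus_power_dvd:
  fixes x :: "'r::comm_ring_1"
  assumes "prime p"
  shows "of_nat p dvd (1 - x) ^ (p ^ a) - (1 - x ^ (p ^ a))"
proof (induction a)
  case (Suc a)
  define y where "y = x ^ (p ^ a)"
  obtain z where z: "(1 - x) ^ (p ^ a) = (1 - y) + of_nat p * z"
    using Suc.IH unfolding y_def dvd_def by (metis add_diff_cancel_left' diff_add_cancel add.commute)
  have 1: "of_nat p dvd (1 - y + of_nat p * z) ^ p - ((1 - y) ^ p + (of_nat p * z) ^ p)"
    by (rule freshmans_dream_dvd[OF assms])
  have 2: "of_nat p dvd (of_nat p * z) ^ p"
    using prime_gt_0_nat[OF assms] by (metis dvd_power dvd_trans dvd_triv_left)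
  \<comment> \<open>Applied to \<open>(1 - y) + y = 1\<close>, the same congruence turns
    \<open>(1 - y) ^ p\<close> into \<open>1 - y ^ p\<close> without a sign case for
    \<open>p = 2\<close>.\<close>
  have 3: "of_nat p dvd (1 - y + y) ^ p - ((1 - y) ^ p + y ^ p)"
    by (rule freshmans_dream_dvd[OF assms])
  have "(1 - x) ^ (p ^ Suc a) - (1 - x ^ (p ^ Suc a)) = (1 - y + of_nat p * z) ^ p - (1 - y ^ p)"
    unfolding power_Suc2 power_mult z y_def ..
  also have "\<dots> = ((1 - y + of_nat p * z) ^ p - ((1 - y) ^ p + (of_nat p * z) ^ p))
     + (of_nat p * z) ^ p - ((1 - y + y) ^ p - ((1 - y) ^ p + y ^ p))" by simp
  also have "of_nat p dvd \<dots>" using 1 2 3 by (blast intro: dvd_add dvd_diff)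
  finally show ?case .
qed simp

subsection \<open>The group algebra modulo a prime\<close>

text \<open>Divide all multiplicities by \<open>p\<close> as long as possible. The size shrinks, so
  this stops at a multiplicity prime to \<open>p\<close>, which can later be cancelled as a
  coefficient.\<close>

lemma repeat_mset_decompose:
  assumes "prime (p::nat)" "T \<noteq> {#}"
  shows "\<exists>a T' h. T = repeat_mset (p ^ a) T' \<and> h \<in># T' \<and> \<not> p dvd count T' h"
  using assms(2)
proof (induction "size T" arbitrary: T rule: less_induct)
  case less
  show ?case
  proof (cases "\<exists>h\<in>#T. \<not> p dvd count T h")
    case True
    then show ?thesis by (intro exI[of _ 0] exI[of _ T]) auto
  next
    case False
    then have dvd: "p dvd count T g" for g by (cases "g \<in># T") (auto simp: not_in_iff)
    define U where "U = (\<Sum>g\<in>set_mset T. replicate_mset (count T g div p) g)"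
    have "count U g = count T g div p" for g
      unfolding U_def count_sum
      by (cases "g \<in># T") (simp_all add: not_in_iff sum.delta' flip: if_distrib)
    then have TU: "T = repeat_mset p U" using dvd by (intro multiset_eqI) simp
    then have "U \<noteq> {#}" using less.prems by auto
    moreover from this have "size U < size T"
      using TU prime_gt_1_nat[OF assms(1)] by (simp add: size_repeat_mset nonempty_has_size)
    ultimately obtain a T' h where "U = repeat_mset (p ^ a) T'" "h \<in># T'" "\<not> p dvd count T' h"
      using less.hyps by blast
    then show ?thesis using TU by (intro exI[of _ "Suc a"] exI[of _ T'] exI[of _ h]) simp
  qed
qed

lemma sum_mset_image_count:
  fixes f :: "'a \<Rightarrow> 'b::comm_semiring_1"
  shows "(\<Sum>g\<in>#S. f g) = (\<Sum>g\<in>set_mset S. of_nat (count S g) * f g)"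
proof (induction S)
  case (add h S)
  have "(\<Sum>g\<in>set_mset S. of_nat (count S g) * f g) = (\<Sum>g\<in>insert h (set_mset S). of_nat (count S g) * f g)"
    by (rule sum.mono_neutral_left) (auto simp: not_in_iff)
  then have "(\<Sum>g\<in>#add_mset h S. f g) = f h + (\<Sum>g\<in>insert h (set_mset S). of_nat (count S g) * f g)"
    using add by simp
  also have "\<dots> = (\<Sum>g\<in>insert h (set_mset S). (if g = h then f g else 0) + of_nat (count S g) * f g)"
    by (simp add: sum.distrib)
  also have "\<dots> = (\<Sum>g\<in>set_mset (add_mset h S). of_nat (count (add_mset h S) g) * f g)"
    by (rule sum.cong) (auto simp: algebra_simps)
  finally show ?case .
qed simp

lemma multiset_indexing:
  obtains I :: "nat set" and g where "finite I" "S = image_mset g (mset_set I)"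
proof -
  obtain gs where gs: "mset gs = S" using ex_mset by blast
  have "S = image_mset ((!) gs) (mset_set {..<length gs})"
    unfolding gs[symmetric] by (metis map_nth mset_map mset_set_upto_eq_mset_upto)
  then show thesis by (rule that[OF finite_lessThan])
qed

lemma subseq_of_size:
  assumes "k \<le> size S"
  obtains V where "V \<subseteq># S" "size V = k"
proof -
  obtain gs where gs: "mset gs = S" using ex_mset by blast
  have "mset (take k gs) + mset (drop k gs) = S" by (simp add: gs flip: mset_append)
  then have "mset (take k gs) \<subseteq># S" by (metis mset_subset_eq_add_left)
  moreover have "size (mset (take k gs)) = k" using assms gs[symmetric] by simp
  ultimately show thesis by (rule that)
qed

section \<open>Sequence sums and the monoid ring covering the group ring\<close>

context comm_group
begin

lemma seq_sum_closed: "seq_over G S \<Longrightarrow> seq_sum G S \<in> carrier G"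
  by (auto simp: seq_sum_def seq_over_def intro!: finprod_closed)

lemma seq_sum_union:
  "seq_over G S \<Longrightarrow> seq_over G T \<Longrightarrow> seq_sum G (S + T) = seq_sum G S \<otimes> seq_sum G T"
proof (induction S)
  case (add g S)
  then have "g \<in> carrier G" "seq_over G S" "seq_over G (S + T)" by (auto simp: seq_over_def)
  then show ?case using add by (simp add: seq_sum_add_mset seq_sum_closed m_assoc)
qed (simp add: seq_sum_empty seq_sum_closed)

lemma seq_sum_repeat_mset:
  assumes "seq_over G S"
  shows "seq_sum G (repeat_mset k S) = seq_sum G S [^] k"
proof (induction k)
  case (Suc k)
  have "seq_over G (repeat_mset k S)"
    by (induction k) (use assms in \<open>simp_all add: seq_over_def\<close>)
  then show ?case
    using Suc assms nat_pow_Suc2[OF seq_sum_closed[OF assms], of k] by (simp add: seq_sum_union)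
qed (simp add: seq_sum_empty)

text \<open>Terms outside the carrier are dropped, so that this is a homomorphism on all multisets.\<close>

definition seq_value :: "'a multiset \<Rightarrow> 'a" where
  "seq_value S = seq_sum G {#g \<in># S. g \<in> carrier G#}"

lemma seq_value_union: "seq_value (S + T) = seq_value S \<otimes> seq_value T"
  by (auto simp: seq_value_def seq_over_def intro!: seq_sum_union)

lemma seq_value_eq: "seq_over G S \<Longrightarrow> seq_value S = seq_sum G S"
  unfolding seq_value_def seq_over_def
  by (rule arg_cong[of _ S]) (auto simp: multiset_eq_iff not_in_iff[symmetric])

text \<open>The monoid ring of the multisets over \<^typ>\<open>'a\<close> stands in for the group ring, of which it is a
  cover: the type \<^typ>\<open>'a\<close> itself carries no group operation. The function below is the coefficient
  at \<open>\<one>\<close> of the image in the group ring.\<close>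

definition unit_coeff :: "('a multiset \<Rightarrow>\<^sub>0 int) \<Rightarrow> int" where
  "unit_coeff r = Poly_Mapping.lookup (frag_extend (\<lambda>S. frag_of (seq_value S)) r) \<one>"

lemma unit_coeff_0 [simp]: "unit_coeff 0 = 0"
  by (simp add: unit_coeff_def)

lemma unit_coeff_add: "unit_coeff (r + s) = unit_coeff r + unit_coeff s"
  by (simp add: unit_coeff_def frag_extend_add lookup_add)

lemma unit_coeff_diff: "unit_coeff (r - s) = unit_coeff r - unit_coeff s"
  by (simp add: unit_coeff_def frag_extend_diff lookup_minus)

lemma unit_coeff_sum: "unit_coeff (sum f A) = (\<Sum>x\<in>A. unit_coeff (f x))"
  by (induction A rule: infinite_finite_induct) (simp_all add: unit_coeff_add)

lemma unit_coeff_of_nat: "unit_coeff (of_nat k * r) = int k * unit_coeff r"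
  by (induction k) (simp_all add: unit_coeff_add algebra_simps)

lemma unit_coeff_sign: "unit_coeff ((- 1) ^ k * r) = (- 1) ^ k * unit_coeff r"
proof (induction k)
  case (Suc k)
  have "unit_coeff (- x) = - unit_coeff x" for x
    using unit_coeff_diff[of 0 x] by simp
  from this[of "(- 1) ^ k * r"] Suc show ?case by simp
qed simp

lemma unit_coeff_frag_of: "unit_coeff (frag_of S) = (if seq_value S = \<one> then 1 else 0)"
  by (simp add: unit_coeff_def)

definition gelt :: "'a \<Rightarrow> 'a multiset \<Rightarrow>\<^sub>0 int" where
  "gelt g = frag_of {#g#}"

definition aug :: "'a \<Rightarrow> 'a multiset \<Rightarrow>\<^sub>0 int" where
  "aug g = 1 - gelt g"

definition aug_prod :: "'a multiset \<Rightarrow> 'a multiset \<Rightarrow>\<^sub>0 int" where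
  "aug_prod S = (\<Prod>g\<in>#S. aug g)"

lemma frag_of_union: "(frag_of (S + T) :: 'a multiset \<Rightarrow>\<^sub>0 int) = frag_of S * frag_of T"
  by (simp add: mult_single)

lemma frag_of_image_mset_set:
  "finite T \<Longrightarrow> frag_of (image_mset g (mset_set T)) = (\<Prod>i\<in>T. gelt (g i))"
proof (induction T rule: finite_induct)
  case (insert i T)
  then show ?case using frag_of_union[of "{#g i#}" "image_mset g (mset_set T)"] by (simp add: gelt_def)
qed simp

lemma aug_prod_empty [simp]: "aug_prod {#} = 1"
  by (simp add: aug_prod_def)

lemma aug_prod_union: "aug_prod (S + T) = aug_prod S * aug_prod T"
  by (simp add: aug_prod_def)

lemma aug_prod_add_mset: "aug_prod (add_mset g S) = aug g * aug_prod S"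
  by (simp add: aug_prod_def)

lemma aug_prod_replicate: "aug_prod (replicate_mset k g) = aug g ^ k"
  by (induction k) (simp_all add: aug_prod_add_mset)

text \<open>Choosing \<open>1\<close> or \<open>- gelt (g i)\<close> in each factor yields the
  subsets \<open>T\<close> with their signs. The coefficient at the identity keeps those for which
  \<open>U\<close> together with the terms of \<open>T\<close> has trivial value.\<close>

lemma unit_coeff_expand:
  assumes "finite I"
  shows "unit_coeff (frag_of U * (\<Prod>i\<in>I. aug (g i))) =
    (\<Sum>T\<in>Pow I. (- 1) ^ card T * of_bool (seq_value (U + image_mset g (mset_set T)) = \<one>))"
proof -
  have "frag_of U * (\<Prod>i\<in>I. aug (g i)) =
     (\<Sum>T\<in>Pow I. (- 1) ^ card T * frag_of (U + image_mset g (mset_set T)))"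
    unfolding aug_def prod_diff_conv_sum[OF assms] sum_distrib_left
  proof (rule sum.cong[OF refl])
    fix T assume "T \<in> Pow I"
    then have "finite T" using assms finite_subset by auto
    then show "frag_of U * ((- 1) ^ card T * (\<Prod>i\<in>T. gelt (g i)) * (\<Prod>i\<in>I - T. 1)) =
        (- 1) ^ card T * frag_of (U + image_mset g (mset_set T))"
      by (simp add: frag_of_union frag_of_image_mset_set mult_ac)
  qed
  then show ?thesis
    by (simp add: unit_coeff_sum unit_coeff_sign unit_coeff_frag_of of_bool_def)
qed

end

section \<open>Reduction modulo \<open>p\<close> in the group algebra of a
  \<open>p\<close>-group\<close>

locale finite_abelian_p_group = comm_group G for G (structure) +
  fixes p n :: nat
  assumes prime_p: "prime p" and fin: "finite (carrier G)" and order_G: "order G = p ^ n"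
begin

text \<open>The trace form of the group algebra is nondegenerate, so this is exactly the kernel of the
  projection to the group algebra over the field with \<^term>\<open>p\<close> elements.\<close>

definition null_ideal :: "('a multiset \<Rightarrow>\<^sub>0 int) set" where
  "null_ideal = {r. \<forall>s. int p dvd unit_coeff (r * s)}"

lemma unit_coeff_null_ideal: "r \<in> null_ideal \<Longrightarrow> int p dvd unit_coeff r"
  unfolding null_ideal_def by (metis (mono_tags) mem_Collect_eq mult.right_neutral)

lemma null_ideal_0: "0 \<in> null_ideal"
  by (simp add: null_ideal_def)

lemma null_ideal_add: "r \<in> null_ideal \<Longrightarrow> s \<in> null_ideal \<Longrightarrow> r + s \<in> null_ideal"
  by (simp add: null_ideal_def distrib_right unit_coeff_add)

lemma null_ideal_diff: "r \<in> null_ideal \<Longrightarrow> s \<in> null_ideal \<Longrightarrow> r - s \<in> null_ideal"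
  by (simp add: null_ideal_def left_diff_distrib unit_coeff_diff)

lemma null_ideal_mult_right: "r \<in> null_ideal \<Longrightarrow> r * s \<in> null_ideal"
  by (simp add: null_ideal_def mult.assoc)

lemma null_ideal_mult_left: "r \<in> null_ideal \<Longrightarrow> s * r \<in> null_ideal"
  using null_ideal_mult_right by (metis mult.commute)

lemma null_ideal_sum: "(\<And>x. x \<in> A \<Longrightarrow> f x \<in> null_ideal) \<Longrightarrow> sum f A \<in> null_ideal"
  by (induction A rule: infinite_finite_induct) (auto intro: null_ideal_0 null_ideal_add)

lemma null_ideal_cong: "r - s \<in> null_ideal \<Longrightarrow> r \<in> null_ideal \<longleftrightarrow> s \<in> null_ideal"
  using null_ideal_add[of "r - s" s] null_ideal_diff[of r "r - s"] by auto

lemma null_ideal_of_nat_dvd: "of_nat p dvd r \<Longrightarrow> r \<in> null_ideal"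
  by (auto simp: null_ideal_def dvd_def mult.assoc unit_coeff_of_nat)

lemma null_ideal_of_nat_mult_cancel:
  assumes "of_nat c * r \<in> null_ideal" "\<not> p dvd c"
  shows "r \<in> null_ideal"
proof -
  have "coprime (int p) (int c)" using assms(2) prime_p by (simp add: prime_imp_coprime)
  then show ?thesis using assms(1)
    by (simp add: null_ideal_def mult.assoc unit_coeff_of_nat coprime_dvd_mult_right_iff)
qed

lemma one_notin_null_ideal: "1 \<notin> null_ideal"
proof
  assume "1 \<in> null_ideal"
  then have "int p dvd unit_coeff 1" by (rule unit_coeff_null_ideal)
  moreover have "unit_coeff (frag_of {#}) = 1"
    unfolding unit_coeff_frag_of by (simp add: seq_value_def seq_sum_empty)
  ultimately show False using prime_p by (simp add: prime_gt_1_nat)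
qed

text \<open>Both elements have the same image in the group ring even before reduction modulo
  \<open>p\<close>; linearity reduces the check to basis elements \<open>U\<close>.\<close>

lemma frag_of_cong_null_ideal:
  assumes "seq_value A = seq_value B"
  shows "frag_of A - frag_of B \<in> null_ideal"
proof -
  have "unit_coeff ((frag_of A - frag_of B) * s) = 0" for s
    using subset_UNIV
  proof (induction s rule: frag_induction)
    case (one U)
    show ?case
      by (simp only: left_diff_distrib frag_of_union[symmetric] unit_coeff_diff
          unit_coeff_frag_of seq_value_union assms diff_self)
  qed (simp_all add: right_diff_distrib unit_coeff_diff)
  then show ?thesis by (simp add: null_ideal_def)
qed

lemma gelt_one: "1 - gelt \<one> \<in> null_ideal"
proof -
  have "frag_of {#} - frag_of {#\<one>#} \<in> null_ideal"
    by (rule frag_of_cong_null_ideal) (simp add: seq_value_def seq_sum_empty seq_sum_add_mset seq_over_def)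
  then show ?thesis by (simp add: gelt_def)
qed

lemma aug_one: "aug \<one> \<in> null_ideal"
  unfolding aug_def by (rule gelt_one)

lemma gelt_mult: "x \<in> carrier G \<Longrightarrow> y \<in> carrier G \<Longrightarrow> gelt x * gelt y - gelt (x \<otimes> y) \<in> null_ideal"
  unfolding gelt_def frag_of_union[symmetric]
  by (rule frag_of_cong_null_ideal) (simp add: m_comm seq_value_def seq_sum_empty seq_sum_add_mset seq_over_def)

lemma aug_mult:
  assumes "x \<in> carrier G" "y \<in> carrier G"
  shows "aug (x \<otimes> y) - (aug x + aug y - aug x * aug y) \<in> null_ideal"
  using gelt_mult[OF assms] by (simp add: aug_def algebra_simps)

lemma gelt_pow:
  assumes "x \<in> carrier G"
  shows "gelt x ^ k - gelt (x [^] k) \<in> null_ideal"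
proof (induction k)
  case 0
  then show ?case using gelt_one by simp
next
  case (Suc k)
  have "gelt x ^ Suc k - gelt (x [^] Suc k) = (gelt x ^ k - gelt (x [^] k)) * gelt x + (gelt (x [^] k) * gelt x - gelt (x [^] k \<otimes> x))"
    by (simp add: algebra_simps)
  then show ?case using Suc assms by (simp only:) (intro null_ideal_add null_ideal_mult_right gelt_mult nat_pow_closed)
qed

lemma aug_pow:
  assumes "x \<in> carrier G"
  shows "aug x ^ (p ^ a) - aug (x [^] (p ^ a)) \<in> null_ideal"
proof -
  have "aug x ^ (p ^ a) - aug (x [^] (p ^ a)) =
     (aug x ^ (p ^ a) - (1 - gelt x ^ (p ^ a))) - (gelt x ^ (p ^ a) - gelt (x [^] (p ^ a)))"
    by (simp add: aug_def)
  moreover have "aug x ^ (p ^ a) - (1 - gelt x ^ (p ^ a)) \<in> null_ideal"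
    unfolding aug_def by (intro null_ideal_of_nat_dvd one_minus_power_dvd prime_p)
  ultimately show ?thesis using gelt_pow[OF assms, of "p ^ a"] null_ideal_diff by metis
qed

text \<open>By pigeonhole some \<open>g\<close> occurs at least \<open>p ^ n\<close> times, and
  \<open>aug g ^ (p ^ n)\<close> is congruent to \<open>aug \<one>\<close>, hence to 0. This crude
  bound serves to ensure that a longest nonzero product exists.\<close>

lemma aug_prod_nilpotent:
  assumes S: "seq_over G S" "p ^ n * p ^ n < size S"
  shows "aug_prod S \<in> null_ideal"
proof -
  have "\<exists>g\<in>#S. p ^ n \<le> count S g"
  proof (rule ccontr)
    assume "\<not> ?thesis"
    then have "size S \<le> (\<Sum>g\<in>set_mset S. p ^ n)"
      unfolding size_multiset_overloaded_eq by (intro sum_mono) auto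
    also have "\<dots> \<le> p ^ n * p ^ n"
      using card_mono[OF fin, of "set_mset S"] S(1) order_G by (simp add: seq_over_def order_def)
    finally show False using S(2) by simp
  qed
  then obtain g where g: "g \<in># S" "p ^ n \<le> count S g" by blast
  then have "g \<in> carrier G" using S(1) by (auto simp: seq_over_def)
  then have "aug g ^ (p ^ n) \<in> null_ideal"
    using aug_pow[of g n] pow_order_eq_1[of g] aug_one null_ideal_cong order_G by metis
  moreover have "S = replicate_mset (p ^ n) g + (S - replicate_mset (p ^ n) g)"
    using g(2) by (metis count_le_replicate_mset_subset_eq subset_mset.add_diff_inverse)
  ultimately show ?thesis
    using aug_prod_union aug_prod_replicate null_ideal_mult_right by metis
qed

text \<open>Modulo quadratic terms, which \<open>z\<close> kills by \<open>sq\<close>,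
  \<open>aug\<close> turns products in the group into sums.\<close>

lemma aug_seq_sum:
  fixes r :: nat
  assumes sq: "\<And>x y. x \<in> carrier G \<Longrightarrow> y \<in> carrier G \<Longrightarrow> z * (aug (x [^] r) * aug (y [^] r)) \<in> null_ideal"
    and T: "seq_over G T"
  shows "z * (aug (seq_sum G T [^] r) - (\<Sum>g\<in>#T. aug (g [^] r))) \<in> null_ideal"
  using T
proof (induction T)
  case empty
  then show ?case using aug_one by (simp add: seq_sum_empty null_ideal_mult_left)
next
  case (add g T)
  then have g: "g \<in> carrier G" and T: "seq_over G T" by (auto simp: seq_over_def)
  define y where "y = seq_sum G T"
  have y: "y \<in> carrier G" unfolding y_def by (rule seq_sum_closed[OF T])
  define s where "s = (\<Sum>g\<in>#T. aug (g [^] r))"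
  have eq: "seq_sum G (add_mset g T) [^] r = g [^] r \<otimes> y [^] r"
    using g y T unfolding y_def by (simp add: seq_sum_add_mset nat_pow_distrib)
  have "z * (aug (g [^] r \<otimes> y [^] r) - (aug (g [^] r) + s)) =
     z * (aug (g [^] r \<otimes> y [^] r) - (aug (g [^] r) + aug (y [^] r) - aug (g [^] r) * aug (y [^] r)))
     + z * (aug (y [^] r) - s) - z * (aug (g [^] r) * aug (y [^] r))"
    by (simp add: algebra_simps)
  also have "\<dots> \<in> null_ideal"
    using null_ideal_mult_left[OF aug_mult[OF nat_pow_closed[OF g] nat_pow_closed[OF y]]] add.IH[OF T] sq[OF g y]
    unfolding y_def[symmetric] s_def[symmetric] by (blast intro: null_ideal_diff null_ideal_add)
  finally show ?case by (simp add: eq s_def)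
qed

subsection \<open>The Davenport constant bounds the nilpotency index\<close>

definition square_weight :: "'a multiset \<Rightarrow> nat" where
  "square_weight S = (\<Sum>g\<in>carrier G. (count S g)\<^sup>2)"

text \<open>The terms \<open>r * r\<close> cancel, leaving a gain of
  \<open>2 * r * (count S g - count S h)\<close>.\<close>

lemma square_weight_exchange:
  assumes "g \<in> carrier G" "h \<in> carrier G" "g \<noteq> h" "0 < r" "count S h < count S g"
  shows "square_weight (S + replicate_mset r h) < square_weight (S + replicate_mset r g)"
proof -
  define Q where "Q = (\<Sum>x\<in>carrier G - {g} - {h}. (count S x)\<^sup>2)"
  have split: "square_weight U = (count U g)\<^sup>2 + ((count U h)\<^sup>2 + Q)"
    if "\<And>x. x \<noteq> g \<Longrightarrow> x \<noteq> h \<Longrightarrow> count U x = count S x" for U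
  proof -
    have "square_weight U = (count U g)\<^sup>2 + ((count U h)\<^sup>2 + (\<Sum>x\<in>carrier G - {g} - {h}. (count U x)\<^sup>2))"
      using sum.remove[OF fin assms(1), of "\<lambda>x. (count U x)\<^sup>2"]
        sum.remove[of "carrier G - {g}" h "\<lambda>x. (count U x)\<^sup>2"] assms(2,3) fin
      by (simp add: square_weight_def)
    also have "(\<Sum>x\<in>carrier G - {g} - {h}. (count U x)\<^sup>2) = Q"
      unfolding Q_def by (rule sum.cong) (use that in auto)
    finally show ?thesis .
  qed
  have "square_weight (S + replicate_mset r g) + 2 * (r * count S h) =
      square_weight (S + replicate_mset r h) + 2 * (r * count S g)"
    using assms(3) by (simp add: split power2_eq_square algebra_simps)
  moreover have "r * count S h < r * count S g" using assms(4,5) by simp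
  ultimately show ?thesis by linarith
qed

text \<open>A zero-sum subsequence, written as \<open>r = p\<^sup>a\<close> copies of \<open>T'\<close> with \<open>a\<close> maximal, gives a linear
  relation with coefficients \<open>count T' g\<close> between the powers \<open>(1 - g)\<^sup>r\<close>, up to products that are too
  long to matter. It lets us trade \<open>r\<close> copies of the rarest \<open>h\<close> for \<open>r\<close> copies of a more frequent
  \<open>g\<close>, which increases the sum of the squared multiplicities.\<close>

lemma maximal_seq_zero_sum_free:
  assumes S: "seq_over G S" "aug_prod S \<notin> null_ideal"
    and longer: "\<And>S'. seq_over G S' \<Longrightarrow> size S < size S' \<Longrightarrow> aug_prod S' \<in> null_ideal"
    and heavier: "\<And>S'. seq_over G S' \<Longrightarrow> size S' = size S \<Longrightarrow>
       square_weight S < square_weight S' \<Longrightarrow> aug_prod S' \<in> null_ideal"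
    and T: "T \<subseteq># S" "zero_sum G T"
  shows "T = {#}"
proof (rule ccontr)
  assume "T \<noteq> {#}"
  then obtain a T' h0 where T': "T = repeat_mset (p ^ a) T'" "h0 \<in># T'" "\<not> p dvd count T' h0"
    using repeat_mset_decompose[OF prime_p] by metis
  define r where "r = p ^ a"
  have r0: "0 < r" using prime_p prime_gt_0_nat by (simp add: r_def)
  \<comment> \<open>Among the terms whose coefficient is prime to \<open>p\<close>, take one that is
    rarest in \<open>S\<close>, so that trading it for any other such term increases the
    weight.\<close>
  obtain h where h: "\<not> p dvd count T' h"
    and h_min: "\<And>g. \<not> p dvd count T' g \<Longrightarrow> count S h \<le> count S g"
    using ex_has_least_nat[of "\<lambda>g. \<not> p dvd count T' g" h0 "count S"] T'(3) by blast
  have "h \<in># T'" by (rule ccontr) (use h in \<open>simp add: not_in_iff\<close>)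
  have cT: "r * count T' g \<le> count S g" for g
    using T(1) mset_subset_eq_count[of T S g] by (simp add: T'(1) r_def)
  have sub: "set_mset T' \<subseteq> set_mset S"
  proof
    fix g assume "g \<in># T'"
    then have "0 < count S g" using cT[of g] r0 by (metis count_greater_zero_iff less_le_trans nat_0_less_mult_iff)
    then show "g \<in># S" by simp
  qed
  have T'_over: "seq_over G T'" using sub S(1) by (auto simp: seq_over_def)
  have hG: "h \<in> carrier G" using \<open>h \<in># T'\<close> T'_over by (auto simp: seq_over_def)
  define S0 where "S0 = S - replicate_mset r h"
  have "r * 1 \<le> r * count T' h" using \<open>h \<in># T'\<close> by (intro mult_le_mono2) (simp add: Suc_le_eq)
  then have "r \<le> count S h" using cT[of h] by linarith
  then have S_eq: "S = S0 + replicate_mset r h"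
    unfolding S0_def by (metis add.commute count_le_replicate_mset_subset_eq subset_mset.add_diff_inverse)
  have S0_over: "seq_over G S0" using S(1) by (simp add: S_eq seq_over_def)
  have over: "seq_over G (U + replicate_mset r g)" if "seq_over G U" "g \<in> carrier G" for U g
    using that by (auto simp: seq_over_def)
  have aug_r: "aug x ^ r - aug (x [^] r) \<in> null_ideal" if "x \<in> carrier G" for x
    unfolding r_def by (rule aug_pow[OF that])
  have swap: "z * aug x ^ r \<in> null_ideal \<longleftrightarrow> z * aug (x [^] r) \<in> null_ideal" if "x \<in> carrier G" for z x
    using null_ideal_cong null_ideal_mult_left[OF aug_r[OF that], of z] by (simp add: right_diff_distrib)
  \<comment> \<open>Here \<open>r\<close> copies of \<open>h\<close> leave and \<open>2 * r\<close>
    terms enter, so the new sequence is longer than \<open>S\<close>.\<close>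
  have sq: "aug_prod S0 * (aug (x [^] r) * aug (y [^] r)) \<in> null_ideal" if "x \<in> carrier G" "y \<in> carrier G" for x y
  proof -
    have "aug_prod (S0 + replicate_mset r x + replicate_mset r y) \<in> null_ideal"
      by (rule longer) (use that over S0_over r0 in \<open>auto simp: S_eq\<close>)
    then have "(aug_prod S0 * aug x ^ r) * aug y ^ r \<in> null_ideal" by (simp add: aug_prod_union aug_prod_replicate)
    then have "(aug_prod S0 * aug x ^ r) * aug (y [^] r) \<in> null_ideal" using swap[OF that(2)] by blast
    then have "(aug_prod S0 * aug (y [^] r)) * aug x ^ r \<in> null_ideal" by (simp only: mult_ac)
    then have "(aug_prod S0 * aug (y [^] r)) * aug (x [^] r) \<in> null_ideal" using swap[OF that(1)] by blast
    then show ?thesis by (simp only: mult_ac)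
  qed
  have "seq_sum G T' [^] r = \<one>"
    using T(2) seq_sum_repeat_mset[OF T'_over] by (simp add: T'(1) r_def zero_sum_def)
  then have "aug_prod S0 * (aug \<one> - (\<Sum>g\<in>#T'. aug (g [^] r))) \<in> null_ideal"
    using aug_seq_sum[OF sq T'_over] by simp
  then have "aug_prod S0 * aug \<one> - aug_prod S0 * (\<Sum>g\<in>#T'. aug (g [^] r)) \<in> null_ideal" by (simp add: right_diff_distrib)
  then have "aug_prod S0 * (\<Sum>g\<in>#T'. aug (g [^] r)) \<in> null_ideal"
    using null_ideal_cong null_ideal_mult_left[OF aug_one] by blast
  also have "(\<Sum>g\<in>#T'. aug (g [^] r)) = (\<Sum>g\<in>set_mset T'. of_nat (count T' g) * aug (g [^] r))"
    by (rule sum_mset_image_count)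
  also have "\<dots> = of_nat (count T' h) * aug (h [^] r)
     + (\<Sum>g\<in>set_mset T' - {h}. of_nat (count T' g) * aug (g [^] r))"
    using \<open>h \<in># T'\<close> by (simp add: sum.remove)
  finally have *: "aug_prod S0 * (of_nat (count T' h) * aug (h [^] r))
     + aug_prod S0 * (\<Sum>g\<in>set_mset T' - {h}. of_nat (count T' g) * aug (g [^] r)) \<in> null_ideal"
    by (simp add: distrib_left)
  have "aug_prod S0 * (of_nat (count T' g) * aug (g [^] r)) \<in> null_ideal" if g: "g \<in> set_mset T' - {h}" for g
  proof (cases "p dvd count T' g")
    case True
    then show ?thesis by (intro null_ideal_mult_left null_ideal_mult_right null_ideal_of_nat_dvd) (auto simp: dvd_def)
  next
    case False
    have gG: "g \<in> carrier G" using g T'_over by (auto simp: seq_over_def)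
    \<comment> \<open>\<open>S0\<close> has lost \<open>r\<close> copies of \<open>h\<close> but
      none of \<open>g\<close>, so the inequality from \<open>h_min\<close> becomes strict
      there.\<close>
    have "square_weight S < square_weight (S0 + replicate_mset r g)"
      unfolding S_eq using h_min[OF False] g r0 gG hG
      by (intro square_weight_exchange) (simp_all add: S_eq)
    then have "aug_prod (S0 + replicate_mset r g) \<in> null_ideal"
      by (intro heavier over S0_over gG) (simp_all add: S_eq)
    then have "aug_prod S0 * aug (g [^] r) \<in> null_ideal" using swap[OF gG] by (simp add: aug_prod_union aug_prod_replicate)
    then show ?thesis using null_ideal_mult_left by (metis mult.left_commute)
  qed
  then have "aug_prod S0 * (\<Sum>g\<in>set_mset T' - {h}. of_nat (count T' g) * aug (g [^] r)) \<in> null_ideal"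
    unfolding sum_distrib_left by (rule null_ideal_sum)
  \<comment> \<open>Only the term of \<open>h\<close> is left; cancelling its coefficient puts
    \<open>aug_prod S\<close> itself into the ideal.\<close>
  from null_ideal_diff[OF * this] have "of_nat (count T' h) * (aug_prod S0 * aug (h [^] r)) \<in> null_ideal"
    by (simp add: mult.left_commute)
  then have "aug_prod S0 * aug h ^ r \<in> null_ideal" using null_ideal_of_nat_mult_cancel h swap[OF hG] by blast
  then show False using S(2) by (simp add: S_eq aug_prod_union aug_prod_replicate)
qed

text \<open>The coefficient at the identity is the signed count of zero-sum subsequences. The empty
  one alone would make it 1, which \<open>p\<close> does not divide.\<close>

lemma ex_zero_sum_subseq:
  assumes S: "seq_over G S" "aug_prod S \<in> null_ideal"
  shows "\<exists>T. T \<subseteq># S \<and> T \<noteq> {#} \<and> zero_sum G T"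
proof (rule ccontr)
  assume free: "\<not> ?thesis"
  obtain I :: "nat set" and g where fI: "finite I" and S_eq: "S = image_mset g (mset_set I)"
    by (rule multiset_indexing)
  have zero: "of_bool (seq_value (image_mset g (mset_set T)) = \<one>) = (of_bool (T = {}) :: int)"
    if "T \<in> Pow I" for T
  proof -
    have "finite T" using that fI finite_subset by auto
    moreover have "image_mset g (mset_set T) \<subseteq># S"
      unfolding S_eq using that fI by (intro image_mset_subseteq_mono subset_imp_msubset_mset_set) auto
    moreover from this have "seq_over G (image_mset g (mset_set T))"
      using S(1) set_mset_mono unfolding seq_over_def by blast
    ultimately show ?thesis
      using free by (auto simp: seq_value_eq zero_sum_def mset_set_empty_iff seq_sum_empty)
  qed
  have "aug_prod S = frag_of {#} * (\<Prod>i\<in>I. aug (g i))"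
    unfolding aug_prod_def S_eq by (simp add: prod_unfold_prod_mset image_mset.compositionality comp_def)
  then have "unit_coeff (aug_prod S) = (\<Sum>T\<in>Pow I. (- 1) ^ card T * of_bool (seq_value (image_mset g (mset_set T)) = \<one>))"
    using unit_coeff_expand[OF fI, of "{#}" g] by simp
  also have "\<dots> = (\<Sum>T\<in>Pow I. if T = {} then 1 else 0)"
    by (rule sum.cong[OF refl]) (simp only: zero, simp)
  also have "\<dots> = 1" using fI by simp
  finally show False using unit_coeff_null_ideal[OF S(2)] prime_gt_1_nat[OF prime_p] by simp
qed

text \<open>A violation leads to a maximal one \<open>U\<close>, first in length and then in square
  weight. The exchange argument makes \<open>U\<close> zero-sum free, although its length is at
  least \<open>davenport G\<close>.\<close>

lemma aug_prod_in_null_ideal: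
  assumes "seq_over G S" "davenport G \<le> size S"
  shows "aug_prod S \<in> null_ideal"
proof (rule ccontr)
  assume "aug_prod S \<notin> null_ideal"
  define L where "L = {size S | S. seq_over G S \<and> aug_prod S \<notin> null_ideal}"
  have bdd: "L \<subseteq> {..p ^ n * p ^ n}"
    using aug_prod_nilpotent unfolding L_def by (auto simp: not_less[symmetric])
  then have fL: "finite L" using finite_subset by blast
  define m where "m = Max L"
  have SL: "size S \<in> L" using assms(1) \<open>aug_prod S \<notin> null_ideal\<close> by (auto simp: L_def)
  then have "m \<in> L" unfolding m_def using fL by (intro Max_in) auto
  have "size S \<le> m" unfolding m_def using fL SL by simp
  have longer: "aug_prod U \<in> null_ideal" if "seq_over G U" "m < size U" for U
  proof (rule ccontr)
    assume "aug_prod U \<notin> null_ideal"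
    then have "size U \<le> m" unfolding m_def using fL that(1) by (intro Max_ge) (auto simp: L_def)
    then show False using that(2) by simp
  qed
  define W where "W = {U. seq_over G U \<and> size U = m \<and> aug_prod U \<notin> null_ideal}"
  have "W \<noteq> {}" using \<open>m \<in> L\<close> by (auto simp: L_def W_def)
  then obtain U0 where "U0 \<in> W" by blast
  moreover have "square_weight U \<le> card (carrier G) * m\<^sup>2" if "U \<in> W" for U
  proof -
    have "(count U g)\<^sup>2 \<le> m\<^sup>2" for g
      using that count_le_size[of U g] by (auto simp: W_def intro: power_mono)
    then show ?thesis
      unfolding square_weight_def using sum_bounded_above[of "carrier G" "\<lambda>g. (count U g)\<^sup>2" "m\<^sup>2"] by simp
  qed
  ultimately obtain U where U: "U \<in> W" "\<And>V. V \<in> W \<Longrightarrow> square_weight V \<le> square_weight U"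
    using ex_has_greatest_nat[of "\<lambda>U. U \<in> W" U0 square_weight "Suc (card (carrier G) * m\<^sup>2)"]
    by (auto simp: less_Suc_eq_le)
  have free: "T = {#}" if "T \<subseteq># U" "zero_sum G T" for T
  proof (rule maximal_seq_zero_sum_free[OF _ _ _ _ that])
    show "aug_prod S' \<in> null_ideal" if "seq_over G S'" "size S' = size U" "square_weight U < square_weight S'" for S'
      using U(1) U(2)[of S'] that by (auto simp: W_def)
  qed (use U(1) longer in \<open>auto simp: W_def\<close>)
  \<comment> \<open>The \<open>LEAST\<close> in \<open>davenport\<close> has its defining property
    once some length is admissible; \<open>Suc m\<close> is, since all products of that length
    vanish.\<close>
  have "\<exists>l. 0 < l \<and> (\<forall>S. seq_over G S \<and> size S = l \<longrightarrow> (\<exists>T. T \<subseteq># S \<and> T \<noteq> {#} \<and> zero_sum G T))"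
    using ex_zero_sum_subseq longer by (intro exI[of _ "Suc m"]) auto
  from LeastI_ex[OF this]
  have dav: "\<exists>T. T \<subseteq># V \<and> T \<noteq> {#} \<and> zero_sum G T" if "seq_over G V" "size V = davenport G" for V
    using that by (auto simp: davenport_def)
  have "davenport G \<le> size U" using assms(2) \<open>size S \<le> m\<close> U(1) by (simp add: W_def)
  then obtain V where V: "V \<subseteq># U" "size V = davenport G"
    by (rule subseq_of_size)
  then have "seq_over G V" using U(1) set_mset_mono[OF V(1)] by (auto simp: W_def seq_over_def)
  from dav[OF this V(2)] show False using free V(1) by (meson subset_mset.order_trans)
qed

subsection \<open>Weighted counts of zero-sum subsequences\<close>

text \<open>Double counting: \<open>card T choose j\<close> is the number of
  \<open>j\<close>-subsets \<open>A\<close> of \<open>T\<close>. For fixed \<open>A\<close>, the sum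
  over all \<open>T\<close> containing \<open>A\<close> is up to sign the coefficient of a multiple
  of a product over \<open>I - A\<close>, which still has at least \<open>davenport G\<close>
  factors.\<close>

lemma zero_sum_choose_cong:
  assumes I: "finite I" "\<And>i. i \<in> I \<Longrightarrow> g i \<in> carrier G" "davenport G + j \<le> card I"
  shows "int p dvd (\<Sum>T\<in>Pow I. (- 1) ^ card T *
    of_bool (zero_sum G (image_mset g (mset_set T))) * int (card T choose j))"
proof -
  define z where "z T = (of_bool (seq_value (image_mset g (mset_set T)) = \<one>) :: int)" for T
  define B where "B = {A. A \<subseteq> I \<and> card A = j}"
  have fB: "finite B" using I(1) by (auto simp: B_def)
  have fin_sub: "finite T" if "T \<subseteq> I" for T using that I(1) finite_subset by blast
  have over: "seq_over G (image_mset g (mset_set T))" if "T \<subseteq> I" for T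
    using that I(2) fin_sub[OF that] by (auto simp: seq_over_def)
  have "(\<Sum>T\<in>Pow I. (- 1) ^ card T * of_bool (zero_sum G (image_mset g (mset_set T))) * int (card T choose j))
      = (\<Sum>T\<in>Pow I. \<Sum>A\<in>B. if A \<subseteq> T then (- 1) ^ card T * z T else 0)"
  proof (rule sum.cong[OF refl])
    fix T assume "T \<in> Pow I"
    then have T: "T \<subseteq> I" by simp
    have "{A \<in> B. A \<subseteq> T} = {A. A \<subseteq> T \<and> card A = j}" using T by (auto simp: B_def)
    then have "int (card T choose j) = int (card {A \<in> B. A \<subseteq> T})"
      using n_subsets[OF fin_sub[OF T], of j] by simp
    moreover have "of_bool (zero_sum G (image_mset g (mset_set T))) = z T"
      using seq_value_eq[OF over[OF T]] by (simp add: z_def zero_sum_def)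
    ultimately show "(- 1) ^ card T * of_bool (zero_sum G (image_mset g (mset_set T))) * int (card T choose j)
      = (\<Sum>A\<in>B. if A \<subseteq> T then (- 1) ^ card T * z T else 0)"
      using fB by (simp flip: sum.inter_filter)
  qed
  also have "\<dots> = (\<Sum>A\<in>B. \<Sum>T\<in>Pow I. if A \<subseteq> T then (- 1) ^ card T * z T else 0)"
    by (rule sum.swap)
  also have "int p dvd \<dots>"
  proof (rule dvd_sum)
    fix A assume "A \<in> B"
    then have A: "A \<subseteq> I" "card A = j" by (auto simp: B_def)
    have fA: "finite A" by (rule fin_sub[OF A(1)])
    define U where "U = image_mset g (mset_set A)"
    have "(\<Sum>T\<in>Pow I. if A \<subseteq> T then (- 1) ^ card T * z T else 0) =
      (\<Sum>T\<in>{T \<in> Pow I. A \<subseteq> T}. (- 1) ^ card T * z T)"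
      using I(1) by (simp flip: sum.inter_filter)
    also have "\<dots> = (\<Sum>T\<in>Pow (I - A). (- 1) ^ j * ((- 1) ^ card T *
        of_bool (seq_value (U + image_mset g (mset_set T)) = \<one>)))"
    proof (rule sum.reindex_bij_witness[of _ "\<lambda>T. A \<union> T" "\<lambda>T. T - A"])
      fix T assume "T \<in> {T \<in> Pow I. A \<subseteq> T}"
      then have T: "T \<subseteq> I" "A \<subseteq> T" by auto
      have fT: "finite T" by (rule fin_sub[OF T(1)])
      have "mset_set T = mset_set A + mset_set (T - A)"
        using mset_set_Union[of A "T - A"] fA fT T(2) by (simp add: Un_absorb1)
      moreover have "card T = j + card (T - A)"
        using A(2) fT T(2) by (metis card_Diff_subset card_mono fA le_add_diff_inverse)
      ultimately show "(- 1) ^ j * ((- 1) ^ card (T - A) *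
          of_bool (seq_value (U + image_mset g (mset_set (T - A))) = \<one>)) = (- 1) ^ card T * z T"
        by (simp add: z_def U_def power_add)
    qed (use A in auto)
    also have "\<dots> = (- 1) ^ j * unit_coeff (frag_of U * (\<Prod>i\<in>I - A. aug (g i)))"
      by (simp only: sum_distrib_left[symmetric] unit_coeff_expand[OF finite_Diff[OF I(1)]])
    also have "int p dvd \<dots>"
    proof (intro dvd_mult unit_coeff_null_ideal null_ideal_mult_left)
      have "(\<Prod>i\<in>I - A. aug (g i)) = aug_prod (image_mset g (mset_set (I - A)))"
        by (simp add: aug_prod_def prod_unfold_prod_mset image_mset.compositionality comp_def)
      also have "\<dots> \<in> null_ideal"
        by (rule aug_prod_in_null_ideal) (use over I(1,3) A fA in \<open>auto simp: card_Diff_subset\<close>)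
      finally show "(\<Prod>i\<in>I - A. aug (g i)) \<in> null_ideal" .
    qed
    finally show "int p dvd (\<Sum>T\<in>Pow I. if A \<subseteq> T then (- 1) ^ card T * z T else 0)" .
  qed
  finally show ?thesis .
qed

lemma zero_sum_fdeg_cong:
  assumes I: "finite I" "\<And>i. i \<in> I \<Longrightarrow> g i \<in> carrier G" "davenport G + e \<le> card I"
    and f: "fdeg_le e f"
  shows "int p dvd (\<Sum>T\<in>Pow I. (- 1) ^ card T *
    of_bool (zero_sum G (image_mset g (mset_set T))) * f (card T))"
proof -
  obtain c where c: "\<And>t. f t = (\<Sum>j\<le>e. c j * int (t choose j))"
    using newton_expansion[OF f] by blast
  have "(\<Sum>T\<in>Pow I. (- 1) ^ card T * of_bool (zero_sum G (image_mset g (mset_set T))) * f (card T)) =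
    (\<Sum>j\<le>e. c j * (\<Sum>T\<in>Pow I. (- 1) ^ card T *
      of_bool (zero_sum G (image_mset g (mset_set T))) * int (card T choose j)))"
    unfolding c sum_distrib_left by (subst sum.swap) (simp only: mult_ac)
  also have "int p dvd \<dots>"
    using I by (intro dvd_sum dvd_mult zero_sum_choose_cong) auto
  finally show ?thesis .
qed

lemma ex_zero_sum_subseq_length:
  fixes M k :: nat and K :: "nat set"
  assumes K: "K \<subseteq> {1..M}" "M \<in> K" "M \<le> p" and q: "q = p ^ k"
    and dav: "davenport G \<le> card K * q"
    and S: "seq_over G S" "size S = (M + 1 - card K) * q + davenport G - 1"
  shows "\<exists>T. T \<subseteq># S \<and> size T \<in> (\<lambda>k. k * q) ` K \<and> zero_sum G T"
proof (rule ccontr)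
  assume none: "\<not> ?thesis"
  have q0: "0 < q" using q prime_gt_0_nat[OF prime_p] by simp
  have fK: "finite K" using K(1) finite_subset by blast
  have cK: "card K \<le> M" using card_mono[OF _ K(1)] by simp
  obtain I :: "nat set" and g where fI: "finite I" and S_eq: "S = image_mset g (mset_set I)"
    by (rule multiset_indexing)
  have cI: "card I = size S" by (simp add: S_eq)
  have gI: "g i \<in> carrier G" if "i \<in> I" for i
    using S(1) that fI by (auto simp: S_eq seq_over_def)
  define A where "A = {1..M} - K"
  have cA: "card A = M - card K" using K(1) fK by (simp add: A_def card_Diff_subset)
  \<comment> \<open>Modulo \<open>p\<close>, the first factor vanishes unless \<open>q\<close> divides \<open>t\<close>, and \<open>t choose q\<close> is \<open>t / q\<close> if it
    does. The shift by \<open>q - 1\<close> avoids the truncated \<open>t - 1\<close> at \<open>t = 0\<close>.\<close>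
  define f where "f t = int ((t + (q - 1)) choose (q - 1)) * (\<Prod>j\<in>A. int (t choose q) + - int j)" for t
  have "fdeg_le q (\<lambda>t. int (t choose q) + - int j)" for j
    using fdeg_le_add[OF fdeg_le_choose[of q 0] fdeg_le_const[of q "- int j"]] by simp
  then have deg: "fdeg_le (q - 1 + card A * q) f"
    unfolding f_def by (intro fdeg_le_mult fdeg_le_choose fdeg_le_prod) (simp_all add: A_def)
  have eq: "(M + 1 - card K) * q = q + card A * q" using cK cA by (simp add: Suc_diff_le)
  \<comment> \<open>The length of \<open>S\<close> exceeds \<open>davenport G\<close> by exactly the
    degree bound of \<open>f\<close>.\<close>
  then have bound: "davenport G + (q - 1 + card A * q) \<le> card I"
    using q0 by (simp add: cI S(2))
  \<comment> \<open>Here \<open>dav\<close> enters: a subsequence whose length is a multiple of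
    \<open>q\<close> then has at most \<open>M * q\<close> terms.\<close>
  have size_less: "size S < (M + 1) * q"
  proof -
    have "(M + 1 - card K) * q + card K * q = (M + 1) * q"
      using cK by (simp flip: add_mult_distrib)
    moreover have "0 < (M + 1 - card K) * q" using cK q0 by simp
    ultimately show ?thesis using dav S(2) by linarith
  qed
  have dvd_f: "int p dvd f (card T)" if T: "T \<subseteq> I" "T \<noteq> {}" "zero_sum G (image_mset g (mset_set T))" for T
  proof (cases "q dvd card T")
    case False
    then have "p dvd ((card T + (q - 1)) choose (q - 1))"
      by (rule prime_dvd_choose_shift[OF prime_p q])
    then show ?thesis unfolding f_def by (intro dvd_mult2) (simp only: int_dvd_int_iff)
  next
    case True
    then obtain j where j: "card T = j * q" by (metis dvd_div_mult_self)
    have fT: "finite T" using T(1) fI finite_subset by blast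
    then have "0 < card T" using T(2) by (simp add: card_gt_0_iff)
    then have "1 \<le> j" using j by (cases j) auto
    have "card T \<le> size S" using card_mono[OF fI T(1)] cI by simp
    then have "j * q < (M + 1) * q" using size_less j by simp
    then have "j < M + 1" by (simp only: mult_less_cancel2)
    then have "j \<le> M" by simp
    have "image_mset g (mset_set T) \<subseteq># S"
      unfolding S_eq using T(1) fI by (intro image_mset_subseteq_mono subset_imp_msubset_mset_set)
    then have "j \<notin> K" using none T(3) j fT by force
    then have "j \<in> A" using \<open>1 \<le> j\<close> \<open>j \<le> M\<close> by (simp add: A_def)
    then have "(int (card T choose q) + - int j) dvd (\<Prod>j\<in>A. int (card T choose q) + - int j)"
      by (intro dvd_prodI) (simp_all add: A_def)
    moreover have "int p dvd int (card T choose q) + - int j"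
      using primepow_mult_choose_cong[OF prime_p q, of j] by (simp add: j)
    ultimately show ?thesis unfolding f_def by (intro dvd_mult) (rule dvd_trans)
  qed
  define F where "F T = (- 1) ^ card T * of_bool (zero_sum G (image_mset g (mset_set T))) * f (card T)" for T
  have "int p dvd (\<Sum>T\<in>Pow I. F T)"
    unfolding F_def by (rule zero_sum_fdeg_cong[OF fI gI bound deg])
  moreover have "(\<Sum>T\<in>Pow I. F T) = F {} + (\<Sum>T\<in>Pow I - {{}}. F T)"
    using fI by (intro sum.remove) auto
  moreover have "int p dvd (\<Sum>T\<in>Pow I - {{}}. F T)"
  proof (rule dvd_sum)
    fix T assume T: "T \<in> Pow I - {{}}"
    show "int p dvd F T"
      using dvd_f[of T] T by (cases "zero_sum G (image_mset g (mset_set T))") (auto simp: F_def)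
  qed
  ultimately have "int p dvd F {}" by (simp add: dvd_add_left_iff)
  \<comment> \<open>At \<open>t = 0\<close> the first factor is
    \<open>(q - 1) choose (q - 1) = 1\<close>, and \<open>0 choose q = 0\<close> as \<open>q\<close>
    is positive.\<close>
  then have "int p dvd (\<Prod>j\<in>A. - int j)"
    using q0 by (simp add: F_def f_def zero_sum_def seq_sum_empty binomial_eq_0)
  then obtain j where j: "j \<in> A" "int p dvd - int j"
    using prime_dvd_prod_iff[of A "int p"] prime_p by (auto simp: A_def)
  then have "p dvd j" by simp
  \<comment> \<open>Since \<open>M\<close> lies in \<open>K\<close>, elements of \<open>A\<close>
    are strictly below \<open>M\<close>, which gives \<open>j < p\<close> even when
    \<open>M = p\<close>.\<close>
  moreover have "0 < j" "j < p" using j(1) K(2,3) by (auto simp: A_def order_le_less)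
  ultimately show False by (auto dest: dvd_imp_le)
qed

end

section \<open>Deduction of the bound on \<open>s_const\<close>\<close>

theorem theorem3:
  fixes G :: "('a, 'b) monoid_scheme" and p n q d :: nat and K :: "nat set"
  assumes "prime p"
    and "comm_group G"
    and "finite (carrier G)"
    and "order G = p ^ n"
    and "group_exp G = q"
    and "\<lceil>real (davenport G) / real q\<rceil> = int d"
    and "K \<subseteq> {1..p}"
    and "card K \<ge> d"
  shows "s_const ((\<lambda>k. k * q) ` K) G \<le> enat ((Max K + 1 - card K) * q + davenport G - 1)"
proof -
  interpret comm_group G by fact
  interpret finite_abelian_p_group G p n
    by unfold_locales (fact assms)+
  \<comment> \<open>As the order of an element, \<open>q\<close> divides the group order and is thus
    a power of \<open>p\<close>.\<close>
  have "q \<in> group.ord G ` carrier G"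
    unfolding assms(5)[symmetric] group_exp_def using assms(3) by (intro Max_in) auto
  then have "q dvd p ^ n" using ord_dvd_group_order assms(4) by auto
  then obtain k where k: "q = p ^ k" using divides_primepow_nat[OF assms(1)] by blast
  have q0: "0 < q" using k prime_gt_0_nat[OF assms(1)] by simp
  have "real (davenport G) / real q \<le> real d"
    using assms(6) by (metis le_of_int_ceiling of_int_of_nat_eq)
  then have "real (davenport G) \<le> real (d * q)" using q0 by (simp add: divide_le_eq)
  then have "davenport G \<le> d * q" by (simp only: of_nat_le_iff)
  also have "d * q \<le> card K * q" using assms(8) by simp
  finally have dav: "davenport G \<le> card K * q" .
  \<comment> \<open>Otherwise the empty product 1 would lie in the ideal. With \<open>dav\<close>,
    positivity also rules out an empty \<open>K\<close>, for which \<open>Max K\<close> would be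
    unspecified.\<close>
  have D0: "0 < davenport G"
  proof (rule ccontr)
    assume "\<not> ?thesis"
    then have "aug_prod {#} \<in> null_ideal" by (intro aug_prod_in_null_ideal) (auto simp: seq_over_def)
    then show False using one_notin_null_ideal by simp
  qed
  have fK: "finite K" using assms(7) finite_subset by blast
  have "K \<noteq> {}" using dav D0 by auto
  then have M: "Max K \<in> K" using fK by simp
  have K: "K \<subseteq> {1..Max K}" using assms(7) fK by (auto simp: Max_ge)
  have "card K \<le> Max K" using card_mono[OF _ K] by simp
  then have "q \<le> (Max K + 1 - card K) * q" by (simp add: Suc_diff_le)
  define l where "l = (Max K + 1 - card K) * q + davenport G - 1"
  have "0 < l" unfolding l_def using q0 D0 \<open>q \<le> _\<close> by linarith
  moreover have "\<exists>T. T \<subseteq># S \<and> size T \<in> (\<lambda>k. k * q) ` K \<and> zero_sum G T"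
    if S: "seq_over G S" "l \<le> size S" for S
  proof -
    \<comment> \<open>Cutting down to length exactly \<open>l\<close> keeps all subsequences shorter
      than \<open>(Max K + 1) * q\<close>.\<close>
    obtain V where V: "V \<subseteq># S" "size V = l" by (rule subseq_of_size[OF S(2)])
    have "seq_over G V" using S(1) set_mset_mono[OF V(1)] by (auto simp: seq_over_def)
    then have "\<exists>T. T \<subseteq># V \<and> size T \<in> (\<lambda>k. k * q) ` K \<and> zero_sum G T"
      using V(2) M assms(7) by (intro ex_zero_sum_subseq_length[OF K M _ k dav]) (auto simp: l_def)
    then show ?thesis using V(1) subset_mset.order_trans by blast
  qed
  ultimately show ?thesis
    unfolding s_const_def l_def[symmetric] by (intro Inf_lower) blast
qed

end
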